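(* Let $(S,d)$ be a bounded metric space with more than one point. Suppose $S$ is doubling and uniformly perfect. Then for every $\Lambda>1$ there exists a visual approximation $\{\mathbf{X}^n\}_{n\in\mathbb{N}_0}$ of width $w=0$ with visual parameter $\Lambda$ for $(S,d)$ in which each cover $\mathbf{X}^n$ is finite.
   Context: $\mathbb{N}_0=\{0,1,2,\dots\}$. $(S,d)$ is uniformly perfect if there is $\lambda\in(0,1)$ such that $B(x,r)\setminus\overline{B(x,\lambda r)}\neq\emptyset$ for all $x\in S$ and $0<r\le \operatorname{diam}(S)$. $(S,d)$ is doubling if there is $N\in\mathbb{N}$ such that every open ball of radius $r>0$ can be covered by $N$ (or fewer) open balls of radius $r/2$. A visual approximation of width $0$ with visual parameter $\Lambda>1$ for $(S,d)$ is a sequence $\{\mathbf{X}^n\}_{n\in\mathbb{N}_0}$ of covers of $S$ (collections of subsets of $S$ with union $S$), with $\mathbf{X}^0=\{S\}$, for which there is a constant $C\ge1$ such that for all $n\in\mathbb{N}_0$ and $X,Y\in\mathbf{X}^n$: (i) $\frac1C\Lambda^{-n}\le\operatorname{diam}(X)\le C\Lambda^{-n}$; (ii) $\operatorname{dist}(X,Y)\ge\frac1C\Lambda^{-n}$ whenever $X\cap Y=\emptyset$, where $\operatorname{dist}(X,Y)=\inf\{d(x,y):x\in X,\,y\in Y\}$. *)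

theory Defs
  imports "HOL-Analysis.Analysis"
begin

text \<open>
  The metric space \<open>(S, d)\<close> is an arbitrary type of class \<^class>\<open>metric_space\<close>,
  with \<open>S = UNIV\<close> and \<open>d = dist\<close>.
  The library's \<^const>\<open>diameter\<close> is real-valued and is the true diameter only of a bounded set;
  an unbounded set has infinite diameter.  Boundedness is therefore spelled out below
  wherever a diameter is compared with a real number.
\<close>

text \<open>The range of radii is \<open>0 < r \<le> diam(S)\<close>, which is no upper bound if \<open>S\<close> is unbounded.\<close>

definition uniformly_perfect :: "'a::metric_space itself \<Rightarrow> bool" where
  "uniformly_perfect _ \<longleftrightarrow>
     (\<exists>\<mu>::real. 0 < \<mu> \<and> \<mu> < 1 \<and>
        (\<forall>(x::'a) r. 0 < r \<and> (bounded (UNIV :: 'a set) \<longrightarrow> r \<le> diameter (UNIV :: 'a set)) \<longrightarrow>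
            ball x r - closure (ball x (\<mu> * r)) \<noteq> {}))"

definition doubling :: "'a::metric_space itself \<Rightarrow> bool" where
  "doubling _ \<longleftrightarrow>
     (\<exists>N::nat. \<forall>(x::'a) r. 0 < r \<longrightarrow>
        (\<exists>A::'a set. finite A \<and> card A \<le> N \<and> ball x r \<subseteq> (\<Union>a\<in>A. ball a (r / 2))))"

text \<open>
  Visual approximations of width \<open>0\<close>.  The constant \<open>C\<close> is uniform in the level \<open>n\<close>.
  The lower bound on the diameter makes every member of every cover nonempty, so that the value
  \<open>0\<close> of \<^const>\<open>setdist\<close> at an empty argument is irrelevant.
\<close>

definition visual_approximation_width0 ::
    "real \<Rightarrow> (nat \<Rightarrow> 'a::metric_space set set) \<Rightarrow> bool" where
  "visual_approximation_width0 \<Lambda> \<X> \<longleftrightarrow>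
     1 < \<Lambda> \<and>
     (\<forall>n. \<Union>(\<X> n) = UNIV) \<and>
     \<X> 0 = {UNIV} \<and>
     (\<exists>C::real. 1 \<le> C \<and>
        (\<forall>n. \<forall>X\<in>\<X> n.
            bounded X \<and>
            1 / C * \<Lambda> powi (- int n) \<le> diameter X \<and>
            diameter X \<le> C * \<Lambda> powi (- int n)) \<and>
        (\<forall>n. \<forall>X\<in>\<X> n. \<forall>Y\<in>\<X> n.
            X \<inter> Y = {} \<longrightarrow> setdist X Y \<ge> 1 / C * \<Lambda> powi (- int n)))"

end

theory Submission
  imports Defs
begin

text \<open>
  All the content is at a single scale \<open>r\<close>.  Covering \<open>S\<close> by balls centred at an \<open>r\<close>-separated
  finite net does not suffice: two such balls can be disjoint and yet arbitrarily close.
  The remedy is to add to each ball \<open>B(a, 2r)\<close> all net points at distance less than \<open>5r\<close> from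
  \<open>a\<close>.  If two balls come within distance \<open>r\<close> of each other, then their centres are less than
  \<open>5r\<close> apart, so the centre of one now belongs to the set built around the other, and the two sets
  intersect.  The added points cannot create new near misses, since two distinct net points are
  at least \<open>r\<close> apart and a net point within \<open>r\<close> of \<open>B(a, 2r)\<close> has itself been added to it.
  This is \<open>net_patch_setdist\<close>.

  The hypotheses enter as follows.  Boundedness and doubling make \<open>S\<close> totally bounded, so that
  finite nets exist at every scale (\<open>finite_separated_net\<close>); uniform perfectness prevents the
  sets from having a diameter much smaller than \<open>r\<close> (\<open>net_patch_diameter_ge\<close>).  The level \<open>n\<close> of
  the approximation is the family obtained at scale \<open>diam(S) * \<Lambda>\<^sup>-\<^sup>n\<close>; the factor
  \<open>diam(S)\<close> keeps the scale within the range of radii for which uniform perfectness speaks.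
\<close>

lemma doubling_imp_finite_ball_cover:
  assumes "doubling TYPE('a::metric_space)" and "bounded (UNIV :: 'a set)" and "0 < r"
  obtains F :: "'a::metric_space set" where "finite F" "(\<Union>a\<in>F. ball a r) = UNIV"
proof -
  obtain x :: 'a and R where "UNIV \<subseteq> ball x R" "0 < R"
    using assms(2) bounded_subset_ballD by blast
  have cover: "\<exists>F::'a set. finite F \<and> (\<Union>a\<in>F. ball a (R / 2 ^ k)) = UNIV" for k
  proof (induction k)
    case 0
    show ?case
      by (rule exI[of _ "{x}"]) (use \<open>UNIV \<subseteq> ball x R\<close> in auto)
  next
    case (Suc k)
    then obtain F :: "'a set" where F: "finite F" "(\<Union>a\<in>F. ball a (R / 2 ^ k)) = UNIV"
      by blast
    have "\<exists>A::'a set. finite A \<and> ball a (R / 2 ^ k) \<subseteq> (\<Union>b\<in>A. ball b (R / 2 ^ k / 2))" for a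
      using assms(1) \<open>0 < R\<close> unfolding doubling_def by (meson divide_pos_pos zero_less_numeral zero_less_power)
    then obtain A :: "'a \<Rightarrow> 'a set" where A:
      "finite (A a)" "ball a (R / 2 ^ k) \<subseteq> (\<Union>b\<in>A a. ball b (R / 2 ^ k / 2))" for a
      by metis
    have half: "R / 2 ^ k / 2 = R / 2 ^ Suc k" by simp
    have "UNIV \<subseteq> (\<Union>b\<in>(\<Union>a\<in>F. A a). ball b (R / 2 ^ Suc k))"
      using F(2) A(2) unfolding half by blast
    moreover have "finite (\<Union>a\<in>F. A a)"
      using F(1) A(1) by blast
    ultimately show ?case by blast
  qed
  obtain k where "R / r < 2 ^ k"
    using real_arch_pow[of 2 "R / r"] by auto
  then have "R / 2 ^ k \<le> r"
    using \<open>0 < r\<close> by (simp add: field_simps)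
  then have "ball a (R / 2 ^ k) \<subseteq> ball a r" for a :: 'a
    by (rule subset_ball)
  moreover obtain F :: "'a set" where F: "finite F" "(\<Union>a\<in>F. ball a (R / 2 ^ k)) = UNIV"
    using cover by blast
  ultimately have "UNIV \<subseteq> (\<Union>a\<in>F. ball a r)"
    by (metis UN_mono order_refl)
  with F(1) show thesis
    using that by (simp add: top.extremum_unique)
qed

definition separated :: "real \<Rightarrow> 'a::metric_space set \<Rightarrow> bool" where
  "separated r A \<longleftrightarrow> (\<forall>a\<in>A. \<forall>b\<in>A. a \<noteq> b \<longrightarrow> r \<le> dist a b)"

text \<open>
  Selecting the net inside a finite set of centres makes finiteness and the existence of a maximal
  separated subset immediate; the price is the covering radius \<open>2 * r\<close> instead of \<open>r\<close>.
\<close>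

lemma finite_separated_net:
  assumes "doubling TYPE('a::metric_space)" and "bounded (UNIV :: 'a set)" and "0 < r"
  obtains A :: "'a::metric_space set" where "finite A" "separated r A" "(\<Union>a\<in>A. ball a (2 * r)) = UNIV"
proof -
  obtain F :: "'a set" where F: "finite F" "(\<Union>a\<in>F. ball a r) = UNIV"
    using doubling_imp_finite_ball_cover[OF assms] .
  define \<S> where "\<S> = {A. A \<subseteq> F \<and> separated r A}"
  have "finite \<S>" "{} \<in> \<S>"
    using F(1) by (auto simp: \<S>_def separated_def)
  then have "\<exists>A\<in>\<S>. \<forall>B\<in>\<S>. A \<subseteq> B \<longrightarrow> A = B"
    by (intro finite_has_maximal) auto
  then obtain A where A: "A \<subseteq> F" "separated r A"
    and max: "\<And>B. B \<subseteq> F \<Longrightarrow> separated r B \<Longrightarrow> A \<subseteq> B \<Longrightarrow> A = B"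
    by (auto simp: \<S>_def)
  have "\<exists>a\<in>A. dist a x < 2 * r" for x
  proof -
    obtain f where f: "f \<in> F" "dist f x < r"
      using F(2) by (metis UNIV_I UN_E mem_ball)
    have "\<exists>a\<in>A. dist a f < r"
    proof (rule ccontr)
      assume far: "\<not> (\<exists>a\<in>A. dist a f < r)"
      then have "separated r (insert f A)"
        using A(2) by (auto simp: separated_def dist_commute not_less)
      then have "f \<in> A"
        using max[of "insert f A"] A(1) f(1) by blast
      with far \<open>0 < r\<close> show False by auto
    qed
    then obtain a where "a \<in> A" "dist a f < r" by blast
    then show ?thesis
      using f(2) dist_triangle[of a x f] by (intro bexI[of _ a]) auto
  qed
  then have "(\<Union>a\<in>A. ball a (2 * r)) = UNIV" by auto
  moreover have "finite A"
    using A(1) F(1) finite_subset by blast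
  ultimately show thesis
    using that A(2) by blast
qed

definition net_patch :: "real \<Rightarrow> 'a::metric_space set \<Rightarrow> 'a \<Rightarrow> 'a set" where
  "net_patch r A a = ball a (2 * r) \<union> (A \<inter> ball a (5 * r))"

lemma net_patch_subset_ball: "0 < r \<Longrightarrow> net_patch r A a \<subseteq> ball a (5 * r)"
  by (auto simp: net_patch_def)

lemma net_patch_bounded: "bounded (net_patch r A a)"
  unfolding net_patch_def by (meson bounded_Un bounded_Int bounded_ball)

lemma net_patch_diameter_le:
  assumes "0 < r"
  shows "diameter (net_patch r A a) \<le> 10 * r"
proof -
  have "dist x y \<le> 10 * r" if "x \<in> net_patch r A a" "y \<in> net_patch r A a" for x y
  proof -
    have "dist a x < 5 * r" "dist a y < 5 * r"
      using net_patch_subset_ball[OF assms, of A a] that by auto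
    then show ?thesis
      using dist_triangle3[of x y a] by linarith
  qed
  moreover have "a \<in> net_patch r A a"
    using assms by (simp add: net_patch_def)
  ultimately show ?thesis
    unfolding diameter_def by (auto intro!: cSUP_least)
qed

text \<open>The annulus \<open>B(a, r) - closure (B(a, \<mu> * r))\<close> contains a point, and it is at distance at
  least \<open>\<mu> * r\<close> from the centre \<open>a\<close>.\<close>

lemma net_patch_diameter_ge:
  fixes a :: "'a::metric_space"
  assumes "0 < r" and "ball a r - closure (ball a (\<mu> * r)) \<noteq> {}"
  shows "\<mu> * r \<le> diameter (net_patch r A a)"
proof -
  obtain x where x: "x \<in> ball a r" "x \<notin> closure (ball a (\<mu> * r))"
    using assms(2) by blast
  then have "x \<notin> ball a (\<mu> * r)"
    using closure_subset by blast
  moreover have "a \<in> net_patch r A a" "x \<in> net_patch r A a"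
    using x(1) assms(1) by (auto simp: net_patch_def)
  then have "dist a x \<le> diameter (net_patch r A a)"
    using diameter_bounded_bound[OF net_patch_bounded] by blast
  ultimately show ?thesis by simp
qed

text \<open>
  Stated in contrapositive form: a near miss is resolved by a net point lying in both sets.
  Each of the two close points is a point of the ball or an added net point.  Ball and ball:
  the centre \<open>b\<close> is within \<open>2r + r + 2r\<close> of \<open>a\<close>.  Ball and net point: the net point is within
  \<open>2r + r\<close> of the centre of the ball.  Net point and net point: they coincide by separation.
\<close>

lemma net_patch_near_imp_meet:
  assumes "0 < r" "separated r A" "a \<in> A" "b \<in> A"
    and "x \<in> net_patch r A a" "y \<in> net_patch r A b" "dist x y < r"
  shows "net_patch r A a \<inter> net_patch r A b \<noteq> {}"
proof -
  have ball_net: "q \<in> net_patch r A c"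
    if "p \<in> ball c (2 * r)" "q \<in> A" "dist p q < r" for c p q
    using that assms(1) dist_triangle[of c q p] by (auto simp: net_patch_def)
  consider "x \<in> ball a (2 * r)" "y \<in> ball b (2 * r)"
    | "x \<in> ball a (2 * r)" "y \<in> A"
    | "x \<in> A" "y \<in> ball b (2 * r)"
    | "x \<in> A" "y \<in> A"
    using assms(5,6) by (auto simp: net_patch_def)
  then show ?thesis
  proof cases
    case 1
    then have "dist a b < 5 * r"
      using assms(7) dist_triangle[of a b x] dist_triangle[of x b y]
      by (simp add: dist_commute)
    then have "b \<in> net_patch r A a" "b \<in> net_patch r A b"
      using assms(1,4) by (auto simp: net_patch_def)
    then show ?thesis by blast
  next
    case 2
    then show ?thesis
      using ball_net assms(6,7) by blast
  next
    case 3
    then have "x \<in> net_patch r A b"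
      using ball_net assms(7) by (metis dist_commute)
    then show ?thesis
      using assms(5) by blast
  next
    case 4
    then have "x = y"
      using assms(2,7) by (force simp: separated_def)
    then show ?thesis
      using assms(5,6) by blast
  qed
qed

lemma net_patch_setdist:
  assumes "0 < r" "separated r A" "a \<in> A" "b \<in> A"
    and "net_patch r A a \<inter> net_patch r A b = {}"
  shows "r \<le> setdist (net_patch r A a) (net_patch r A b)"
proof (rule le_setdistI)
  show "net_patch r A a \<noteq> {}" "net_patch r A b \<noteq> {}"
    using assms(1) by (auto simp: net_patch_def)
  show "r \<le> dist x y" if "x \<in> net_patch r A a" "y \<in> net_patch r A b" for x y
    using net_patch_near_imp_meet[OF assms(1-4) that] assms(5) by fastforce
qed

lemma single_scale_cover:
  fixes r \<mu> :: real
  assumes "doubling TYPE('a::metric_space)" and "bounded (UNIV :: 'a set)" and "0 < r"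
    and perfect: "\<And>x::'a. ball x r - closure (ball x (\<mu> * r)) \<noteq> {}"
  obtains \<C> :: "'a::metric_space set set" where
    "finite \<C>" "\<Union>\<C> = UNIV"
    "\<forall>X\<in>\<C>. bounded X \<and> \<mu> * r \<le> diameter X \<and> diameter X \<le> 10 * r"
    "\<forall>X\<in>\<C>. \<forall>Y\<in>\<C>. X \<inter> Y = {} \<longrightarrow> r \<le> setdist X Y"
proof -
  obtain A :: "'a set" where A: "finite A" "separated r A" "(\<Union>a\<in>A. ball a (2 * r)) = UNIV"
    using finite_separated_net[OF assms(1-3)] .
  show thesis
  proof (rule that[of "net_patch r A ` A"])
    show "finite (net_patch r A ` A)"
      using A(1) by simp
    show "\<Union>(net_patch r A ` A) = UNIV"
      using A(3) unfolding net_patch_def by blast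
    show "\<forall>X\<in>net_patch r A ` A. bounded X \<and> \<mu> * r \<le> diameter X \<and> diameter X \<le> 10 * r"
      using net_patch_bounded net_patch_diameter_le[OF assms(3)]
        net_patch_diameter_ge[OF assms(3) perfect] by blast
    show "\<forall>X\<in>net_patch r A ` A. \<forall>Y\<in>net_patch r A ` A. X \<inter> Y = {} \<longrightarrow> r \<le> setdist X Y"
      using net_patch_setdist[OF assms(3) A(2)] by blast
  qed
qed

theorem corollary3p7:
  fixes \<Lambda> :: real
  assumes "bounded (UNIV :: 'a::metric_space set)"
    and "\<exists>x y :: 'a. x \<noteq> y"
    and "doubling TYPE('a)"
    and "uniformly_perfect TYPE('a)"
    and "\<Lambda> > 1"
  shows "\<exists>\<X> :: nat \<Rightarrow> 'a set set.
           visual_approximation_width0 \<Lambda> \<X> \<and> (\<forall>n. finite (\<X> n))"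
proof -
  define D where "D = diameter (UNIV :: 'a set)"
  obtain x y :: 'a where "x \<noteq> y"
    using assms(2) by auto
  then have "0 < dist x y" by simp
  also have "dist x y \<le> D"
    unfolding D_def by (rule diameter_bounded_bound[OF assms(1)]) auto
  finally have "0 < D" .
  obtain \<mu> where \<mu>: "0 < \<mu>" "\<mu> < 1"
    and perfect: "\<And>(x::'a) r. 0 < r \<Longrightarrow> r \<le> D \<Longrightarrow> ball x r - closure (ball x (\<mu> * r)) \<noteq> {}"
    using assms(4) unfolding uniformly_perfect_def D_def by blast
  define s where "s n = \<Lambda> powi (- int n)" for n
  have s_eq: "s n = inverse (\<Lambda> ^ n)" for n
    by (simp add: s_def power_int_minus)
  have s: "0 < s n" "s n \<le> 1" "s 0 = 1" for n
    using assms(5) one_le_power[of \<Lambda> n] by (auto simp: s_eq inverse_le_1_iff)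
  define good where "good n \<C> \<longleftrightarrow> finite \<C> \<and> \<Union>\<C> = UNIV
      \<and> (\<forall>X\<in>\<C>. bounded X \<and> \<mu> * (D * s n) \<le> diameter X \<and> diameter X \<le> 10 * (D * s n))
      \<and> (\<forall>X\<in>\<C>. \<forall>Y\<in>\<C>. X \<inter> Y = {} \<longrightarrow> D * s n \<le> setdist X Y)" for n and \<C> :: "'a set set"
  have "\<exists>\<C>. good n \<C>" for n
  proof -
    have r: "0 < D * s n" "D * s n \<le> D"
      using \<open>0 < D\<close> s(1,2)[of n] by (auto simp: mult_left_le)
    obtain \<C> :: "'a set set" where "finite \<C>" "\<Union>\<C> = UNIV"
      "\<forall>X\<in>\<C>. bounded X \<and> \<mu> * (D * s n) \<le> diameter X \<and> diameter X \<le> 10 * (D * s n)"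
      "\<forall>X\<in>\<C>. \<forall>Y\<in>\<C>. X \<inter> Y = {} \<longrightarrow> D * s n \<le> setdist X Y"
      by (rule single_scale_cover[OF assms(3,1) r(1) perfect[OF r]])
    then have "good n \<C>"
      by (simp add: good_def)
    then show ?thesis by blast
  qed
  then obtain \<C> where \<C>: "\<And>n. good n (\<C> n)" by metis
  define \<X> where "\<X> = \<C>(0 := {UNIV})"
  have "good 0 {UNIV}"
    using \<open>0 < D\<close> \<mu> assms(1) s(3) by (simp add: good_def D_def[symmetric])
  then have \<X>: "good n (\<X> n)" for n
    using \<C> by (simp add: \<X>_def)
  \<comment> \<open>\<open>C\<close> dominates \<open>10 * D\<close> (upper bound on diameters) and the reciprocal of \<open>\<mu> * D\<close>
      (lower bound on diameters); since \<open>\<mu> < 1\<close>, the latter also serves for the distances.\<close>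
  define C where "C = max 1 (max (10 * D) (1 / (\<mu> * D)))"
  have C: "1 \<le> C" "10 * D \<le> C" "1 / (\<mu> * D) \<le> C"
    by (auto simp: C_def)
  have "1 / C \<le> \<mu> * D"
    using C \<mu> \<open>0 < D\<close> by (simp add: field_simps)
  moreover have "\<mu> * D \<le> D"
    using \<mu> \<open>0 < D\<close> by simp
  ultimately have CD: "1 / C \<le> \<mu> * D" "1 / C \<le> D" "10 * D \<le> C"
    using C(2) by linarith+
  have bounds:
    "1 / C * s n \<le> \<mu> * (D * s n)" "1 / C * s n \<le> D * s n" "10 * (D * s n) \<le> C * s n" for n
    using CD[THEN mult_right_mono, of "s n"] s(1)[of n] by (simp_all add: mult.assoc)
  have "visual_approximation_width0 \<Lambda> \<X>"
    unfolding visual_approximation_width0_def s_def[symmetric]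
  proof (intro conjI exI[of _ C])
    show "1 < \<Lambda>" "1 \<le> C"
      using assms(5) C(1) by auto
    show "\<forall>n. \<Union>(\<X> n) = UNIV"
      using \<X> by (simp add: good_def)
    show "\<X> 0 = {UNIV}"
      by (simp add: \<X>_def)
    show "\<forall>n. \<forall>X\<in>\<X> n. bounded X \<and> 1 / C * s n \<le> diameter X \<and> diameter X \<le> C * s n"
      using \<X> bounds unfolding good_def by (meson order_trans)
    show "\<forall>n. \<forall>X\<in>\<X> n. \<forall>Y\<in>\<X> n. X \<inter> Y = {} \<longrightarrow> 1 / C * s n \<le> setdist X Y"
      using \<X> bounds unfolding good_def by (meson order_trans)
  qed
  then show ?thesis
    using \<X> unfolding good_def by blast
qed

end
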